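(* Let $k,n,m\in\mathbb{N}$ and let $\mathbf{H}$ be a random oracle drawn uniformly from $\mathsf{Fcs}(k,n,m)$. Let $\mathcal{A}$ be an order-consistent quantum adversary that makes $p$ quantum queries to the random oracle $\mathbf{H}$ and $q$ classical queries to $\textsc{Ev}$. Then \[\mathsf{Adv}^{\mathsf{prf}}_{\mathsf{FFX}}(\mathcal{A})\le\sqrt{\frac{8(p+q)pq}{2^{k+n}}}.\]
   Context: $\mathsf{Fcs}(k,n,m)$ is the set of all functions $\mathbf{H}:\{0,1\}^k\times\{0,1\}^n\to\{0,1\}^m$. We write $\mathbf{H}_K(x)=\mathbf{H}(K,x)$. Quantum access to $\mathbf{H}$ is the unitary $|K,x,y\rangle\mapsto|K,x,y\oplus\mathbf{H}_K(x)\rangle$. The construction FFX with key $K_1\|K_2\in\{0,1\}^k\times\{0,1\}^n$ is $\mathsf{FFX}[\mathbf{H}](K_1\|K_2,x)=\mathbf{H}_{K_1}(x\oplus K_2)$. The PRF game with bit $b$ samples $\mathbf{H}$ uniformly, a uniform key $K_1\|K_2$, and an independent uniform function $F:\{0,1\}^n\to\{0,1\}^m$. The adversary has quantum access to $\mathbf{H}$ and classical access to $\textsc{Ev}$: - if $b=1$, $\textsc{Ev}$ returns $\mathsf{FFX}[\mathbf{H}](K_1\|K_2,\cdot)$; - if $b=0$, $\textsc{Ev}$ returns $F(\cdot)$. The advantage is $\Pr[\mathcal{A}\text{ outputs }1\mid b=1]-\Pr[\mathcal{A}\text{ outputs }1\mid b=0]$. An adversary with several oracles is order consistent if the order in which it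 alternates between queries to the different oracles is fixed a priori, before execution. *)

theory Defs
  imports Complex_Main "HOL-Library.FuncSet"
begin

text \<open>
  Model of an order-consistent quantum adversary in the PRF game for FFX.
  Bit strings of length l are encoded as natural numbers < 2^l; XOR of bit strings
  is bitwise xor on nat.  The adversary's Hilbert space has the computational basis
  (K,x,y,u,v,w): (K,x,y) is the register for quantum queries to H, (u,v) is the
  register for classical queries to Ev, w ranges over a finite work space of size d.
\<close>

type_synonym basis = "nat \<times> nat \<times> nat \<times> nat \<times> nat \<times> nat"
type_synonym qstate = "basis \<Rightarrow> complex"
type_synonym qop = "basis \<Rightarrow> basis \<Rightarrow> complex"

definition Basis :: "nat \<Rightarrow> nat \<Rightarrow> nat \<Rightarrow> nat \<Rightarrow> basis set" where
  "Basis k n m d = {(K,x,y,u,v,w). K < 2^k \<and> x < 2^n \<and> y < 2^m \<and> u < 2^n \<and> v < 2^m \<and> w < d}"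

definition unitary_on :: "basis set \<Rightarrow> qop \<Rightarrow> bool" where
  "unitary_on S U \<longleftrightarrow>
     (\<forall>b b'. b \<notin> S \<or> b' \<notin> S \<longrightarrow> U b b' = 0) \<and>
     (\<forall>b\<in>S. \<forall>b'\<in>S. (\<Sum>c\<in>S. cnj (U c b) * U c b') = (if b = b' then 1 else 0))"

definition apply_op :: "basis set \<Rightarrow> qop \<Rightarrow> qstate \<Rightarrow> qstate" where
  "apply_op S U \<psi> = (\<lambda>b. if b \<in> S then (\<Sum>b'\<in>S. U b b' * \<psi> b') else 0)"

definition ket0 :: qstate where
  "ket0 = (\<lambda>b. if b = (0,0,0,0,0,0) then 1 else 0)"

definition oracle_H :: "basis set \<Rightarrow> (nat \<times> nat \<Rightarrow> nat) \<Rightarrow> qstate \<Rightarrow> qstate" where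
  "oracle_H S H \<psi> = (\<lambda>(K,x,y,u,v,w).
     if (K,x,y,u,v,w) \<in> S then \<psi> (K, x, Bit_Operations.xor y (H (K,x)), u, v, w) else 0)"

text \<open>Projection onto outcome u0 of the (computational basis) measurement of the
  Ev input register: this makes the Ev query classical.\<close>
definition proj_u :: "nat \<Rightarrow> qstate \<Rightarrow> qstate" where
  "proj_u u0 \<psi> = (\<lambda>(K,x,y,u,v,w). if u = u0 then \<psi> (K,x,y,u,v,w) else 0)"

definition oracle_Ev :: "basis set \<Rightarrow> (nat \<Rightarrow> nat) \<Rightarrow> qstate \<Rightarrow> qstate" where
  "oracle_Ev S E \<psi> = (\<lambda>(K,x,y,u,v,w).
     if (K,x,y,u,v,w) \<in> S then \<psi> (K, x, y, u, Bit_Operations.xor v (E u), w) else 0)"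

text \<open>Probability that the adversary outputs 1, starting from (unnormalised branch)
  state psi and executing the remaining steps.  A step (True, U) is a quantum query to H
  followed by the unitary U; a step (False, U) is a classical query to Ev followed by U.
  The classical query measures the Ev input register (summing over outcomes u0).
  At the end the adversary measures in the computational basis and outputs 1 iff the
  outcome lies in acc.  The list of steps (hence the order of queries) is fixed a priori:
  this is order consistency.\<close>
primrec acc_prob :: "nat \<Rightarrow> nat \<Rightarrow> nat \<Rightarrow> nat \<Rightarrow> basis set \<Rightarrow> (nat \<times> nat \<Rightarrow> nat) \<Rightarrow>
    (nat \<Rightarrow> nat) \<Rightarrow> (bool \<times> qop) list \<Rightarrow> qstate \<Rightarrow> real" where
  "acc_prob k n m d acc H E [] \<psi> =
     (\<Sum>b\<in>Basis k n m d. if b \<in> acc then (cmod (\<psi> b))^2 else 0)"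
| "acc_prob k n m d acc H E (st # sts) \<psi> =
     (if fst st
      then acc_prob k n m d acc H E sts
             (apply_op (Basis k n m d) (snd st) (oracle_H (Basis k n m d) H \<psi>))
      else (\<Sum>u0<2^n. acc_prob k n m d acc H E sts
             (apply_op (Basis k n m d) (snd st)
                (oracle_Ev (Basis k n m d) E (proj_u u0 \<psi>)))))"

definition Fcs :: "nat \<Rightarrow> nat \<Rightarrow> nat \<Rightarrow> (nat \<times> nat \<Rightarrow> nat) set" where
  "Fcs k n m = PiE ({..<2^k} \<times> {..<2^n}) (\<lambda>_. {..<2^m})"

definition Funs :: "nat \<Rightarrow> nat \<Rightarrow> (nat \<Rightarrow> nat) set" where
  "Funs n m = PiE {..<2^n} (\<lambda>_. {..<2^m})"

definition FFX :: "(nat \<times> nat \<Rightarrow> nat) \<Rightarrow> nat \<Rightarrow> nat \<Rightarrow> nat \<Rightarrow> nat" where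
  "FFX H K1 K2 x = H (K1, Bit_Operations.xor x K2)"

definition prf_real :: "nat \<Rightarrow> nat \<Rightarrow> nat \<Rightarrow> nat \<Rightarrow> basis set \<Rightarrow> qop \<Rightarrow> (bool \<times> qop) list \<Rightarrow> real" where
  "prf_real k n m d acc U0 sts =
     (\<Sum>H\<in>Fcs k n m. \<Sum>K1<2^k. \<Sum>K2<2^n.
        acc_prob k n m d acc H (FFX H K1 K2) sts (apply_op (Basis k n m d) U0 ket0))
     / (real (card (Fcs k n m)) * 2^k * 2^n)"

definition prf_ideal :: "nat \<Rightarrow> nat \<Rightarrow> nat \<Rightarrow> nat \<Rightarrow> basis set \<Rightarrow> qop \<Rightarrow> (bool \<times> qop) list \<Rightarrow> real" where
  "prf_ideal k n m d acc U0 sts =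
     (\<Sum>H\<in>Fcs k n m. \<Sum>F\<in>Funs n m.
        acc_prob k n m d acc H F sts (apply_op (Basis k n m d) U0 ket0))
     / (real (card (Fcs k n m)) * real (card (Funs n m)))"

definition adv_prf_FFX :: "nat \<Rightarrow> nat \<Rightarrow> nat \<Rightarrow> nat \<Rightarrow> basis set \<Rightarrow> qop \<Rightarrow> (bool \<times> qop) list \<Rightarrow> real" where
  "adv_prf_FFX k n m d acc U0 sts = prf_real k n m d acc U0 sts - prf_ideal k n m d acc U0 sts"

end

theory Submission
  imports Defs "HOL-Analysis.L2_Norm"
begin

text \<open>
  Fix the list \<open>us\<close> of measured \<open>Ev\<close> inputs.  Exchanging the values of \<open>H\<close> at \<open>(K1, u \<oplus> K2)\<close> with
  those of an independent \<open>F\<close> at \<open>u\<close>, for all \<open>u\<close> in \<open>us\<close>, preserves the uniform distribution of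
  \<open>(H, F)\<close>.  It turns the real game into one where \<open>Ev\<close> is answered by \<open>F\<close> and \<open>H\<close> is reprogrammed at
  the points \<open>(K1, u \<oplus> K2)\<close>.  We track the \<open>L\<^sup>2\<close> distance, over all keys, functions and branches \<open>us\<close>,
  between the states of this game and of the ideal one.  Let \<open>N = 2^(k+n)\<close>.

  A query to \<open>H\<close> adds at most \<open>2 sqrt (q / N)\<close>: the ideal state does not depend on the key, and each
  basis state queries a reprogrammed point for at most \<open>q\<close> of the \<open>N\<close> keys.  A query to \<open>Ev\<close> with a
  fresh input reprograms one more point, which is uniform given the ideal state; it adds at most
  \<open>2 sqrt (p / N)\<close>, because the total influence of the \<open>N\<close> values of \<open>H\<close> on the ideal state grows by at
  most 4 with every query to \<open>H\<close>.  The distance of the final states is thus at most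
  \<open>2 (p sqrt q + q sqrt p) / sqrt N\<close>, and it bounds the difference of the acceptance probabilities.
\<close>

section \<open>Bit strings, finite sets and norms of states\<close>

lemma xor_less_power_2:
  fixes a b :: nat
  assumes "a < 2 ^ l" "b < 2 ^ l"
  shows "Bit_Operations.xor a b < 2 ^ l"
  using assms by (metis take_bit_nat_eq_self_iff take_bit_xor)

lemma xor_xor_cancel [simp]:
  fixes a b :: nat
  shows "Bit_Operations.xor (Bit_Operations.xor a b) b = a"
  by (simp add: xor.assoc)

lemma xor_xor_cancel_left [simp]:
  fixes a b :: nat
  shows "Bit_Operations.xor (Bit_Operations.xor a b) a = b"
  by (metis xor.commute xor_xor_cancel)

lemma xor_less_power_2_iff:
  fixes a b :: nat
  assumes "b < 2 ^ l"
  shows "Bit_Operations.xor a b < 2 ^ l \<longleftrightarrow> a < 2 ^ l"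
  using assms xor_less_power_2[of a l b] xor_less_power_2[of "Bit_Operations.xor a b" l b] by auto

lemma finite_Basis [simp]: "finite (Basis k n m d)"
  by (rule finite_subset[of _ "{..<2^k} \<times> {..<2^n} \<times> {..<2^m} \<times> {..<2^n} \<times> {..<2^m} \<times> {..<d}"])
     (auto simp: Basis_def)

lemma finite_Fcs [simp]: "finite (Fcs k n m)"
  by (simp add: Fcs_def finite_PiE)

lemma finite_Funs [simp]: "finite (Funs n m)"
  by (simp add: Funs_def finite_PiE)

lemma Fcs_less: "H \<in> Fcs k n m \<Longrightarrow> a < 2^k \<Longrightarrow> x < 2^n \<Longrightarrow> H (a, x) < 2^m"
  by (auto simp: Fcs_def PiE_def Pi_def)

lemma Funs_less: "F \<in> Funs n m \<Longrightarrow> u < 2^n \<Longrightarrow> F u < 2^m"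
  by (auto simp: Funs_def PiE_def Pi_def)

lemma cmod_diff_square_le: "(cmod (a - b))\<^sup>2 \<le> 2 * (cmod a)\<^sup>2 + 2 * (cmod b)\<^sup>2"
proof -
  have "(cmod (a - b))\<^sup>2 \<le> (cmod a + cmod b)\<^sup>2"
    by (intro power_mono norm_triangle_ineq4) auto
  also have "\<dots> \<le> 2 * (cmod a)\<^sup>2 + 2 * (cmod b)\<^sup>2"
    using sum_squares_bound[of "cmod a" "cmod b"] by (simp add: power2_sum)
  finally show ?thesis .
qed

lemma apply_op_diff:
  "apply_op S U (\<lambda>b. \<psi> b - \<phi> b) b = apply_op S U \<psi> b - apply_op S U \<phi> b"
  by (simp add: apply_op_def sum_subtractf algebra_simps)

lemma cnj_mult_self_eq: "cnj z * z = complex_of_real ((cmod z)\<^sup>2)"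
  by (metis complex_norm_square mult.commute)

lemma sum_norm_apply_op:
  assumes "unitary_on S U"
  shows "(\<Sum>b\<in>S. (cmod (apply_op S U \<psi> b))\<^sup>2) = (\<Sum>b\<in>S. (cmod (\<psi> b))\<^sup>2)"
proof -
  have "complex_of_real (\<Sum>c\<in>S. (cmod (apply_op S U \<psi> c))\<^sup>2)
      = (\<Sum>c\<in>S. cnj (\<Sum>b\<in>S. U c b * \<psi> b) * (\<Sum>b\<in>S. U c b * \<psi> b))"
    unfolding of_real_sum
    by (intro sum.cong refl) (simp add: apply_op_def cnj_mult_self_eq del: of_real_power cnj_sum)
  also have "\<dots> = (\<Sum>c\<in>S. \<Sum>b\<in>S. \<Sum>b'\<in>S. cnj (\<psi> b) * \<psi> b' * (cnj (U c b) * U c b'))"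
    unfolding cnj_sum sum_product by (simp add: mult_ac)
  also have "\<dots> = (\<Sum>b\<in>S. \<Sum>c\<in>S. \<Sum>b'\<in>S. cnj (\<psi> b) * \<psi> b' * (cnj (U c b) * U c b'))"
    by (rule sum.swap)
  also have "\<dots> = (\<Sum>b\<in>S. \<Sum>b'\<in>S. \<Sum>c\<in>S. cnj (\<psi> b) * \<psi> b' * (cnj (U c b) * U c b'))"
    by (intro sum.cong refl sum.swap)
  also have "\<dots> = (\<Sum>b\<in>S. \<Sum>b'\<in>S. cnj (\<psi> b) * \<psi> b' * (\<Sum>c\<in>S. cnj (U c b) * U c b'))"
    by (simp add: sum_distrib_left)
  also have "\<dots> = (\<Sum>b\<in>S. \<Sum>b'\<in>S. if b = b' then cnj (\<psi> b) * \<psi> b' else 0)"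
    using assms by (intro sum.cong refl) (auto simp: unitary_on_def)
  also have "\<dots> = complex_of_real (\<Sum>b\<in>S. (cmod (\<psi> b))\<^sup>2)"
  \<comment> \<open>For infinite \<open>S\<close> every sum over \<open>S\<close> is 0 by
    convention.\<close>
  proof (cases "finite S")
    case True
    then show ?thesis by (simp add: cnj_mult_self_eq del: of_real_power)
  qed auto
  finally show ?thesis
    using of_real_eq_iff by blast
qed

text \<open>Since both sums equal \<open>T\<close>, the gap is half the signed sum in which the outcomes outside \<open>P\<close> count
  negatively; this saves a factor 2 over the direct Cauchy-Schwarz estimate.\<close>

lemma measurement_gap_le:
  fixes a b :: "'i \<Rightarrow> complex"
  assumes a: "(\<Sum>i\<in>I. (cmod (a i))\<^sup>2) = T" and b: "(\<Sum>i\<in>I. (cmod (b i))\<^sup>2) = T"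
  shows "(\<Sum>i\<in>I. if i \<in> P then (cmod (a i))\<^sup>2 else 0) - (\<Sum>i\<in>I. if i \<in> P then (cmod (b i))\<^sup>2 else 0)
    \<le> L2_set (\<lambda>i. cmod (a i - b i)) I * sqrt T"
proof -
  define \<delta> where "\<delta> i = (cmod (a i))\<^sup>2 - (cmod (b i))\<^sup>2" for i
  let ?gap = "\<Sum>i\<in>I. if i \<in> P then \<delta> i else 0"
  have "(\<Sum>i\<in>I. \<delta> i) = 0"
    by (simp add: \<delta>_def sum_subtractf a b)
  then have "2 * ?gap = (\<Sum>i\<in>I. 2 * (if i \<in> P then \<delta> i else 0) - \<delta> i)"
    by (simp add: sum_subtractf sum_distrib_left)
  also have "\<dots> \<le> (\<Sum>i\<in>I. \<bar>cmod (a i - b i)\<bar> * \<bar>cmod (a i) + cmod (b i)\<bar>)"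
  proof (rule sum_mono)
    fix i
    have "2 * (if i \<in> P then \<delta> i else 0) - \<delta> i \<le> \<bar>\<delta> i\<bar>" by auto
    also have "\<bar>\<delta> i\<bar> = \<bar>cmod (a i) - cmod (b i)\<bar> * \<bar>cmod (a i) + cmod (b i)\<bar>"
      unfolding abs_mult[symmetric] by (simp add: \<delta>_def power2_eq_square algebra_simps)
    also have "\<dots> \<le> \<bar>cmod (a i - b i)\<bar> * \<bar>cmod (a i) + cmod (b i)\<bar>"
      using norm_triangle_ineq3[of "a i" "b i"] by (intro mult_right_mono) auto
    finally show "2 * (if i \<in> P then \<delta> i else 0) - \<delta> i
        \<le> \<bar>cmod (a i - b i)\<bar> * \<bar>cmod (a i) + cmod (b i)\<bar>" .
  qed
  also have "\<dots> \<le> L2_set (\<lambda>i. cmod (a i - b i)) I * L2_set (\<lambda>i. cmod (a i) + cmod (b i)) I"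
    by (rule L2_set_mult_ineq)
  also have "\<dots> \<le> L2_set (\<lambda>i. cmod (a i - b i)) I * (sqrt T + sqrt T)"
    using L2_set_triangle_ineq[of "\<lambda>i. cmod (a i)" "\<lambda>i. cmod (b i)" I] a b
    by (intro mult_left_mono) (auto simp: L2_set_def sum_nonneg)
  finally have "?gap \<le> L2_set (\<lambda>i. cmod (a i - b i)) I * sqrt T"
    by simp
  moreover have "?gap = (\<Sum>i\<in>I. if i \<in> P then (cmod (a i))\<^sup>2 else 0)
      - (\<Sum>i\<in>I. if i \<in> P then (cmod (b i))\<^sup>2 else 0)"
    unfolding sum_subtractf[symmetric] by (intro sum.cong) (auto simp: \<delta>_def)
  ultimately show ?thesis by simp
qed

section \<open>Norm preservation by the oracles; exchange of values between \<open>H\<close> and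
  \<open>F\<close>\<close>

text \<open>XOR with \<open>H (K,x)\<close> permutes the basis states and fixes the query register
  \<open>(K,x)\<close>, so any weight \<open>g\<close> on that register is carried along. A constant
  \<open>g\<close> yields an isometry; the indicator of a point or of a set of points yields
  conservation of query weight.\<close>

lemma sum_oracle_H:
  assumes "H \<in> Fcs k n m"
  shows "(\<Sum>b\<in>Basis k n m d. g (fst b, fst (snd b)) *
            (cmod (oracle_H (Basis k n m d) H \<psi> b - oracle_H (Basis k n m d) H \<phi> b))\<^sup>2)
       = (\<Sum>b\<in>Basis k n m d. g (fst b, fst (snd b)) * (cmod (\<psi> b - \<phi> b))\<^sup>2)"
  by (rule sum.reindex_bij_witness
        [of _ "\<lambda>(K,x,y,u,v,w). (K, x, Bit_Operations.xor y (H (K,x)), u, v, w)"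
              "\<lambda>(K,x,y,u,v,w). (K, x, Bit_Operations.xor y (H (K,x)), u, v, w)"])
     (use assms in \<open>auto simp: Basis_def oracle_H_def Fcs_less xor_less_power_2\<close>)

lemma sum_oracle_Ev:
  assumes "\<And>u. u < 2^n \<Longrightarrow> E u < 2^m"
  shows "(\<Sum>b\<in>Basis k n m d.
            (cmod (oracle_Ev (Basis k n m d) E \<psi> b - oracle_Ev (Basis k n m d) E \<phi> b))\<^sup>2)
       = (\<Sum>b\<in>Basis k n m d. (cmod (\<psi> b - \<phi> b))\<^sup>2)"
  by (rule sum.reindex_bij_witness
        [of _ "\<lambda>(K,x,y,u,v,w). (K, x, y, u, Bit_Operations.xor v (E u), w)"
              "\<lambda>(K,x,y,u,v,w). (K, x, y, u, Bit_Operations.xor v (E u), w)"])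
     (use assms in \<open>auto simp: Basis_def oracle_Ev_def xor_less_power_2\<close>)

text \<open>Each basis state survives exactly one of the projections, the one onto its own
  \<open>Ev\<close> input.\<close>

lemma sum_proj_u:
  "(\<Sum>u<2^n. \<Sum>b\<in>Basis k n m d. (cmod (proj_u u \<psi> b - proj_u u \<phi> b))\<^sup>2)
     = (\<Sum>b\<in>Basis k n m d. (cmod (\<psi> b - \<phi> b))\<^sup>2)"
proof -
  have "(\<Sum>u<2^n. (cmod (proj_u u \<psi> b - proj_u u \<phi> b))\<^sup>2) = (cmod (\<psi> b - \<phi> b))\<^sup>2"
    if "b \<in> Basis k n m d" for b
  proof -
    obtain K x y u v w where b: "b = (K,x,y,u,v,w)" by (cases b) auto
    have "(\<Sum>u'<2^n. (cmod (proj_u u' \<psi> b - proj_u u' \<phi> b))\<^sup>2)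
        = (\<Sum>u'<2^n. if u' = u then (cmod (\<psi> b - \<phi> b))\<^sup>2 else 0)"
      by (intro sum.cong) (auto simp: b proj_u_def)
    then show ?thesis using that by (simp add: b Basis_def)
  qed
  then show ?thesis by (subst sum.swap) simp
qed

text \<open>The two components of the exchange of \<open>H\<close> at \<open>(K1, u \<oplus> K2)\<close> with \<open>F\<close> at \<open>u\<close>, for \<open>u \<in> V\<close>.\<close>

definition reprog :: "nat \<times> nat \<Rightarrow> nat set \<Rightarrow> (nat \<times> nat \<Rightarrow> nat) \<Rightarrow> (nat \<Rightarrow> nat) \<Rightarrow> nat \<times> nat \<Rightarrow> nat" where
  "reprog K V H F = (\<lambda>(a, x). if a = fst K \<and> Bit_Operations.xor x (snd K) \<in> V
     then F (Bit_Operations.xor x (snd K)) else H (a, x))"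

definition reprog_back :: "nat \<times> nat \<Rightarrow> nat set \<Rightarrow> (nat \<times> nat \<Rightarrow> nat) \<Rightarrow> (nat \<Rightarrow> nat) \<Rightarrow> nat \<Rightarrow> nat" where
  "reprog_back K V H F = (\<lambda>u. if u \<in> V then H (fst K, Bit_Operations.xor u (snd K)) else F u)"

lemma reprog_in_Fcs:
  assumes "H \<in> Fcs k n m" "F \<in> Funs n m" "K \<in> {..<2^k} \<times> {..<2^n}" "V \<subseteq> {..<2^n}"
  shows "reprog K V H F \<in> Fcs k n m"
  using assms
  by (auto simp: reprog_def Fcs_def Funs_def PiE_iff extensional_def xor_less_power_2_iff subset_iff)

lemma reprog_back_in_Funs:
  assumes "H \<in> Fcs k n m" "F \<in> Funs n m" "K \<in> {..<2^k} \<times> {..<2^n}" "V \<subseteq> {..<2^n}"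
  shows "reprog_back K V H F \<in> Funs n m"
  using assms
  by (auto simp: reprog_back_def Fcs_def Funs_def PiE_iff extensional_def xor_less_power_2_iff subset_iff)

lemma reprog_reprog [simp]: "reprog K V (reprog K V H F) (reprog_back K V H F) = H"
  by (auto simp: reprog_def reprog_back_def fun_eq_iff)

lemma reprog_back_reprog [simp]: "reprog_back K V (reprog K V H F) (reprog_back K V H F) = F"
  by (auto simp: reprog_def reprog_back_def fun_eq_iff)

text \<open>For a fixed key and a fixed \<open>V\<close> the exchange is an involution on pairs
  \<open>(H, F)\<close>, hence a permutation of them. Since \<open>V\<close> will depend on the
  outcomes, uses of this lemma first move the sum over outcomes to the outside.\<close>

lemma sum_reprog:
  fixes f :: "(nat \<times> nat \<Rightarrow> nat) \<Rightarrow> (nat \<Rightarrow> nat) \<Rightarrow> real"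
  assumes "K \<in> {..<2^k} \<times> {..<2^n}" "V \<subseteq> {..<2^n}"
  shows "(\<Sum>H\<in>Fcs k n m. \<Sum>F\<in>Funs n m. f (reprog K V H F) (reprog_back K V H F))
       = (\<Sum>H\<in>Fcs k n m. \<Sum>F\<in>Funs n m. f H F)"
  unfolding sum.cartesian_product
  by (rule sum.reindex_bij_witness
        [of _ "\<lambda>(H,F). (reprog K V H F, reprog_back K V H F)"
              "\<lambda>(H,F). (reprog K V H F, reprog_back K V H F)"])
     (use assms in \<open>auto simp: reprog_in_Fcs reprog_back_in_Funs\<close>)

text \<open>The exchange can be done in two stages. Removing \<open>set us\<close> matters: a
  repeated \<open>u\<close> would otherwise be exchanged twice, which restores the old value of
  \<open>H\<close>.\<close>

lemma reprog_insert:
  "reprog K (set (u # us)) H F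
     = reprog K (set us) (reprog K ({u} - set us) H F) (reprog_back K ({u} - set us) H F)"
  by (auto simp: reprog_def reprog_back_def fun_eq_iff)

lemma reprog_singleton:
  "reprog (a, x) {u} H F = H((a, Bit_Operations.xor x u) := F u)"
  by (auto simp: reprog_def fun_eq_iff xor.commute xor.left_commute)

text \<open>Swapping \<open>H pt\<close> with the separate value \<open>y\<close> is an involution
  on pairs \<open>(H, y)\<close>. So a uniform function stays uniform when one value is resampled,
  and the old value is independent of the result.\<close>

lemma sum_fun_upd:
  fixes f :: "('a \<Rightarrow> 'b) \<Rightarrow> 'b \<Rightarrow> real"
  assumes "pt \<in> A"
  shows "(\<Sum>H\<in>PiE A (\<lambda>_. B). \<Sum>y\<in>B. f (H(pt := y)) (H pt))
       = (\<Sum>H\<in>PiE A (\<lambda>_. B). \<Sum>y\<in>B. f H y)"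
  unfolding sum.cartesian_product
  by (rule sum.reindex_bij_witness
        [of _ "\<lambda>(H, y). (H(pt := y), H pt)" "\<lambda>(H, y). (H(pt := y), H pt)"])
     (use assms in \<open>auto simp: PiE_iff extensional_def\<close>)


section \<open>The game as a sum over measured branches\<close>

locale ffx_game =
  fixes k n m d :: nat and init :: qstate
begin

abbreviation "S \<equiv> Basis k n m d"
abbreviation "Pts \<equiv> {..<(2::nat)^k} \<times> {..<(2::nat)^n}"

definition sqdist :: "qstate \<Rightarrow> qstate \<Rightarrow> real" where
  "sqdist \<psi> \<phi> = (\<Sum>b\<in>S. (cmod (\<psi> b - \<phi> b))\<^sup>2)"

definition sqnorm :: "qstate \<Rightarrow> real" where
  "sqnorm \<psi> = (\<Sum>b\<in>S. (cmod (\<psi> b))\<^sup>2)"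

definition outcomes :: "nat \<Rightarrow> nat list set" where
  "outcomes j = {us. set us \<subseteq> {..<2^n} \<and> length us = j}"

abbreviation num_H :: "(bool \<times> qop) list \<Rightarrow> nat" where
  "num_H rs \<equiv> length (filter fst rs)"

abbreviation num_Ev :: "(bool \<times> qop) list \<Rightarrow> nat" where
  "num_Ev rs \<equiv> length (filter (\<lambda>st. \<not> fst st) rs)"

abbreviation unitary_steps :: "(bool \<times> qop) list \<Rightarrow> bool" where
  "unitary_steps rs \<equiv> \<forall>st\<in>set rs. unitary_on S (snd st)"

text \<open>The unnormalised state after the steps \<open>rs\<close> in the branch where the measured inputs of the
  \<open>Ev\<close> queries are \<open>us\<close>.  In both lists the most recent entry comes first.\<close>

primrec branch :: "(bool \<times> qop) list \<Rightarrow> nat list \<Rightarrow> (nat \<times> nat \<Rightarrow> nat) \<Rightarrow> (nat \<Rightarrow> nat) \<Rightarrow> qstate" where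
  "branch [] us H E = init"
| "branch (st # rs) us H E = apply_op S (snd st)
     (if fst st then oracle_H S H (branch rs us H E)
      else oracle_Ev S E (proj_u (hd us) (branch rs (tl us) H E)))"

lemma outcomes_0 [simp]: "outcomes 0 = {[]}"
  by (auto simp: outcomes_def)

lemma outcomes_subset: "us \<in> outcomes j \<Longrightarrow> set us \<subseteq> {..<2^n}"
  and outcomes_length: "us \<in> outcomes j \<Longrightarrow> length us = j"
  by (auto simp: outcomes_def)

lemma sum_outcomes_Suc:
  "(\<Sum>us\<in>outcomes (Suc j). f us) = (\<Sum>us\<in>outcomes j. \<Sum>u<2^n. f (u # us))"
  unfolding sum.cartesian_product
  by (rule sum.reindex_bij_witness[of _ "\<lambda>(us, u). u # us" "\<lambda>us. (tl us, hd us)"])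
     (auto simp: outcomes_def length_Suc_conv)

lemma sqdist_nonneg [simp]: "0 \<le> sqdist \<psi> \<phi>"
  by (simp add: sqdist_def sum_nonneg)

lemma sqnorm_nonneg [simp]: "0 \<le> sqnorm \<psi>"
  by (simp add: sqnorm_def sum_nonneg)

lemma sqdist_self [simp]: "sqdist \<psi> \<psi> = 0"
  by (simp add: sqdist_def)

lemma sqdist_0: "sqdist \<psi> (\<lambda>_. 0) = sqnorm \<psi>"
  by (simp add: sqdist_def sqnorm_def)

lemma sqdist_apply_op:
  "unitary_on S U \<Longrightarrow> sqdist (apply_op S U \<psi>) (apply_op S U \<phi>) = sqdist \<psi> \<phi>"
  unfolding sqdist_def apply_op_diff[symmetric] by (rule sum_norm_apply_op)

lemma sqnorm_apply_op: "unitary_on S U \<Longrightarrow> sqnorm (apply_op S U \<psi>) = sqnorm \<psi>"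
  unfolding sqnorm_def by (rule sum_norm_apply_op)

lemma sqdist_oracle_H:
  "H \<in> Fcs k n m \<Longrightarrow> sqdist (oracle_H S H \<psi>) (oracle_H S H \<phi>) = sqdist \<psi> \<phi>"
  unfolding sqdist_def using sum_oracle_H[where g = "\<lambda>_. 1"] by simp

lemma oracle_H_0 [simp]: "oracle_H S H (\<lambda>_. 0) = (\<lambda>_. 0)"
  by (auto simp: oracle_H_def)

lemma oracle_Ev_0 [simp]: "oracle_Ev S E (\<lambda>_. 0) = (\<lambda>_. 0)"
  by (auto simp: oracle_Ev_def)

lemma proj_u_0 [simp]: "proj_u u (\<lambda>_. 0) = (\<lambda>_. 0)"
  by (auto simp: proj_u_def)

lemma sqnorm_oracle_H: "H \<in> Fcs k n m \<Longrightarrow> sqnorm (oracle_H S H \<psi>) = sqnorm \<psi>"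
  using sqdist_oracle_H[of H \<psi> "\<lambda>_. 0"] by (simp add: sqdist_0)

lemma sqdist_oracle_Ev:
  "(\<And>u. u < 2^n \<Longrightarrow> E u < 2^m) \<Longrightarrow> sqdist (oracle_Ev S E \<psi>) (oracle_Ev S E \<phi>) = sqdist \<psi> \<phi>"
  unfolding sqdist_def by (rule sum_oracle_Ev)

lemma sqnorm_oracle_Ev:
  "(\<And>u. u < 2^n \<Longrightarrow> E u < 2^m) \<Longrightarrow> sqnorm (oracle_Ev S E \<psi>) = sqnorm \<psi>"
  using sqdist_oracle_Ev[of E \<psi> "\<lambda>_. 0"] by (simp add: sqdist_0)

lemma sum_sqdist_proj_u: "(\<Sum>u<2^n. sqdist (proj_u u \<psi>) (proj_u u \<phi>)) = sqdist \<psi> \<phi>"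
  unfolding sqdist_def by (rule sum_proj_u)

lemma sum_sqnorm_proj_u: "(\<Sum>u<2^n. sqnorm (proj_u u \<psi>)) = sqnorm \<psi>"
  using sum_sqdist_proj_u[of \<psi> "\<lambda>_. 0"] by (simp add: sqdist_0)

lemma sum_sqnorm_branch:
  assumes "unitary_steps rs" "H \<in> Fcs k n m" "\<And>u. u < 2^n \<Longrightarrow> E u < 2^m"
  shows "(\<Sum>us\<in>outcomes (num_Ev rs). sqnorm (branch rs us H E)) = sqnorm init"
  using assms(1)
proof (induction rs)
  case (Cons st rs)
  then show ?case
    using assms(2,3)
    by (cases "fst st")
       (simp_all add: sqnorm_apply_op sqnorm_oracle_H sqnorm_oracle_Ev sum_outcomes_Suc
          sum_sqnorm_proj_u)
qed simp

text \<open>The projection before each \<open>Ev\<close> query leaves only components whose input is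
  the recorded outcome, so \<open>E\<close> is consulted nowhere else. This allows \<open>F\<close>
  to be traded for \<open>FFX\<close> or for an exchanged function.\<close>

lemma branch_cong:
  assumes "\<And>u. u \<in> set us \<Longrightarrow> E u = E' u" "length us = num_Ev rs"
  shows "branch rs us H E = branch rs us H E'"
  using assms
proof (induction rs arbitrary: us)
  case (Cons st rs)
  show ?case
  proof (cases "fst st")
    case True
    then show ?thesis using Cons by simp
  next
    case False
    then obtain u vs where us: "us = u # vs"
      using Cons.prems(2) by (cases us) auto
    have "branch rs vs H E = branch rs vs H E'"
      using Cons False us by simp
    moreover have "oracle_Ev S E (proj_u u \<psi>) = oracle_Ev S E' (proj_u u \<psi>)" for \<psi>
      using Cons.prems(1)[of u] by (auto simp: us oracle_Ev_def proj_u_def fun_eq_iff)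
    ultimately show ?thesis using False us by simp
  qed
qed simp

definition acc_weight :: "basis set \<Rightarrow> qstate \<Rightarrow> real" where
  "acc_weight acc \<psi> = (\<Sum>b\<in>S. if b \<in> acc then (cmod (\<psi> b))\<^sup>2 else 0)"

text \<open>\<open>acc_prob\<close> runs the steps forwards while \<open>branch\<close> keeps the
  latest step first, hence the reversal. The induction needs an arbitrary list \<open>rs\<close> of
  steps already executed.\<close>

lemma sum_acc_prob_branch:
  "(\<Sum>us\<in>outcomes (num_Ev rs). acc_prob k n m d acc H E sts (branch rs us H E))
     = (\<Sum>us\<in>outcomes (num_Ev (rev sts @ rs)). acc_weight acc (branch (rev sts @ rs) us H E))"
proof (induction sts arbitrary: rs)
  case Nil
  then show ?case by (simp add: acc_weight_def)
next
  case (Cons st sts)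
  show ?case
    using Cons.IH[of "st # rs"] by (cases "fst st") (simp_all add: sum_outcomes_Suc)
qed

lemma acc_prob_eq_sum_branch:
  "acc_prob k n m d acc H E sts init
     = (\<Sum>us\<in>outcomes (num_Ev (rev sts)). acc_weight acc (branch (rev sts) us H E))"
  using sum_acc_prob_branch[where rs = "[]"] by simp

section \<open>Influence of single values of \<open>H\<close>\<close>

text \<open>The query magnitude of \<open>pt\<close>: for a unit state, the probability that
  measuring the query register yields \<open>pt\<close>.\<close>

definition hit :: "nat \<times> nat \<Rightarrow> qstate \<Rightarrow> real" where
  "hit pt \<psi> = (\<Sum>b\<in>S. of_bool ((fst b, fst (snd b)) = pt) * (cmod (\<psi> b))\<^sup>2)"

lemma sum_hit: "(\<Sum>pt\<in>Pts. hit pt \<psi>) = sqnorm \<psi>"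
proof -
  have eq: "(\<Sum>pt\<in>Pts. of_bool ((fst b, fst (snd b)) = pt) * (cmod (\<psi> b))\<^sup>2) = (cmod (\<psi> b))\<^sup>2"
    if "b \<in> S" for b
  proof -
    have "(fst b, fst (snd b)) \<in> Pts" using that by (auto simp: Basis_def)
    moreover have "(\<Sum>pt\<in>Pts. of_bool ((fst b, fst (snd b)) = pt) * (cmod (\<psi> b))\<^sup>2)
        = (\<Sum>pt\<in>Pts. if pt = (fst b, fst (snd b)) then (cmod (\<psi> b))\<^sup>2 else 0)"
      by (intro sum.cong) auto
    ultimately show ?thesis by simp
  qed
  show ?thesis unfolding hit_def sqnorm_def by (subst sum.swap) (rule sum.cong[OF refl eq])
qed

lemma hit_oracle_H: "H \<in> Fcs k n m \<Longrightarrow> hit pt (oracle_H S H \<psi>) = hit pt \<psi>"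
  unfolding hit_def using sum_oracle_H[of H k n m "\<lambda>p. of_bool (p = pt)" d \<psi> "\<lambda>_. 0"] by simp

text \<open>Off \<open>pt\<close> the two oracles act alike, and the isometry accounts for the first
  term. On \<open>pt\<close> the squared difference is at most twice the sum of the squared moduli,
  and both oracles conserve the query magnitude. Bounding squares directly, without the triangle
  inequality, gives increments that simply add up over the queries.\<close>

lemma sqdist_oracle_H_fun_upd:
  assumes H: "H \<in> Fcs k n m" and H': "H(pt := y) \<in> Fcs k n m"
  shows "sqdist (oracle_H S (H(pt := y)) \<psi>) (oracle_H S H \<phi>) \<le> sqdist \<psi> \<phi> + 2 * hit pt \<psi> + 2 * hit pt \<phi>"
proof -
  have "sqdist (oracle_H S (H(pt := y)) \<psi>) (oracle_H S H \<phi>)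
     \<le> (\<Sum>b\<in>S. (cmod (oracle_H S H \<psi> b - oracle_H S H \<phi> b))\<^sup>2
          + 2 * (of_bool ((fst b, fst (snd b)) = pt) * (cmod (oracle_H S (H(pt := y)) \<psi> b))\<^sup>2)
          + 2 * (of_bool ((fst b, fst (snd b)) = pt) * (cmod (oracle_H S H \<phi> b))\<^sup>2))"
    unfolding sqdist_def
  proof (rule sum_mono)
    fix b assume "b \<in> S"
    show "(cmod (oracle_H S (H(pt := y)) \<psi> b - oracle_H S H \<phi> b))\<^sup>2
     \<le> (cmod (oracle_H S H \<psi> b - oracle_H S H \<phi> b))\<^sup>2
          + 2 * (of_bool ((fst b, fst (snd b)) = pt) * (cmod (oracle_H S (H(pt := y)) \<psi> b))\<^sup>2)
          + 2 * (of_bool ((fst b, fst (snd b)) = pt) * (cmod (oracle_H S H \<phi> b))\<^sup>2)"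
    proof (cases "(fst b, fst (snd b)) = pt")
      case True
      then show ?thesis
        using cmod_diff_square_le[of "oracle_H S (H(pt := y)) \<psi> b" "oracle_H S H \<phi> b"]
        by (simp add: add_increasing add.assoc)
    next
      case False
      then have "oracle_H S (H(pt := y)) \<psi> b = oracle_H S H \<psi> b"
        by (cases b) (auto simp: oracle_H_def)
      then show ?thesis by simp
    qed
  qed
  also have "\<dots> = sqdist (oracle_H S H \<psi>) (oracle_H S H \<phi>)
      + 2 * hit pt (oracle_H S (H(pt := y)) \<psi>) + 2 * hit pt (oracle_H S H \<phi>)"
    by (simp only: sum.distrib sqdist_def hit_def sum_distrib_left)
  also have "\<dots> = sqdist \<psi> \<phi> + 2 * hit pt \<psi> + 2 * hit pt \<phi>"
    using H H' by (simp add: sqdist_oracle_H hit_oracle_H)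
  finally show ?thesis .
qed

text \<open>Up to normalisation, the expected squared distance caused by resampling one value of
  \<open>H\<close>, added up over all points.\<close>

definition influence :: "(bool \<times> qop) list \<Rightarrow> real" where
  "influence rs = (\<Sum>pt\<in>Pts. \<Sum>H\<in>Fcs k n m. \<Sum>y<2^m. \<Sum>F\<in>Funs n m. \<Sum>us\<in>outcomes (num_Ev rs).
     sqdist (branch rs us (H(pt := y)) F) (branch rs us H F))"

text \<open>Squared norms are summed, not averaged, over the functions; this is their total for one
  key.\<close>

definition total_weight :: real where
  "total_weight = real (card (Fcs k n m)) * real (card (Funs n m)) * sqnorm init"

lemma fun_upd_in_Fcs: "H \<in> Fcs k n m \<Longrightarrow> pt \<in> Pts \<Longrightarrow> y < 2^m \<Longrightarrow> H(pt := y) \<in> Fcs k n m"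
  by (auto simp: Fcs_def PiE_iff extensional_def)

lemma sum_sqnorm_branch_Fcs_Funs:
  assumes "unitary_steps rs"
  shows "(\<Sum>H\<in>Fcs k n m. \<Sum>F\<in>Funs n m. \<Sum>us\<in>outcomes (num_Ev rs). sqnorm (branch rs us H F))
       = total_weight"
  using assms by (simp add: sum_sqnorm_branch Funs_less total_weight_def)

lemma sum_Fcs_fun_upd:
  fixes f :: "(nat \<times> nat \<Rightarrow> nat) \<Rightarrow> real"
  assumes "pt \<in> Pts"
  shows "(\<Sum>H\<in>Fcs k n m. \<Sum>y<2^m. f (H(pt := y))) = (\<Sum>H\<in>Fcs k n m. \<Sum>y<(2::nat)^m. f H)"
  using sum_fun_upd[OF assms, of "\<lambda>H _. f H" "{..<2^m}"] by (simp only: Fcs_def)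

lemma sum_Funs_fun_upd:
  fixes g :: "(nat \<Rightarrow> nat) \<Rightarrow> nat \<Rightarrow> real"
  assumes "u < 2^n"
  shows "(\<Sum>F\<in>Funs n m. \<Sum>y<2^m. g (F(u := y)) (F u)) = (\<Sum>F\<in>Funs n m. \<Sum>y<2^m. g F y)"
  using sum_fun_upd[of u "{..<2^n}" g "{..<2^m}"] assms by (simp only: Funs_def lessThan_iff)

text \<open>A query to \<open>Ev\<close> acts on both states by the same isometry and changes
  nothing. A query to \<open>H\<close> adds twice the query magnitudes of both states at
  \<open>pt\<close>; over all \<open>pt\<close> these sum to the full squared norm of each state,
  whence 2 + 2 = 4.\<close>

lemma influence_le:
  assumes "unitary_steps rs"
  shows "influence rs \<le> 4 * real (num_H rs) * (2^m * total_weight)"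
  using assms
proof (induction rs)
  case Nil
  then show ?case by (simp add: influence_def)
next
  case (Cons st rs)
  then have IH: "influence rs \<le> 4 * real (num_H rs) * (2^m * total_weight)"
    and U: "unitary_on S (snd st)" and rs: "unitary_steps rs" by auto
  show ?case
  proof (cases "fst st")
    case False
    have "influence (st # rs) = influence rs"
      using False U unfolding influence_def
      by (intro sum.cong[OF refl])
         (simp add: sqdist_apply_op sqdist_oracle_Ev Funs_less sum_outcomes_Suc sum_sqdist_proj_u)
    then show ?thesis using IH False by simp
  next
    case True
    let ?j = "num_Ev rs"
    have bound: "influence (st # rs) \<le> (\<Sum>pt\<in>Pts. \<Sum>H\<in>Fcs k n m. \<Sum>y<2^m. \<Sum>F\<in>Funs n m. \<Sum>us\<in>outcomes ?j.
       sqdist (branch rs us (H(pt := y)) F) (branch rs us H F)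
       + 2 * hit pt (branch rs us (H(pt := y)) F) + 2 * hit pt (branch rs us H F))"
    proof -
      have j: "num_Ev (st # rs) = ?j" using True by simp
      show ?thesis
        unfolding influence_def j
      proof (intro sum_mono)
        fix pt H y F us assume "pt \<in> Pts" "H \<in> Fcs k n m" "y \<in> {..<(2::nat)^m}"
        then show "sqdist (branch (st # rs) us (H(pt := y)) F) (branch (st # rs) us H F)
            \<le> sqdist (branch rs us (H(pt := y)) F) (branch rs us H F)
              + 2 * hit pt (branch rs us (H(pt := y)) F) + 2 * hit pt (branch rs us H F)"
          using True U sqdist_oracle_H_fun_upd fun_upd_in_Fcs by (simp add: sqdist_apply_op)
      qed
    qed
    define h where "h pt H = (\<Sum>F\<in>Funs n m. \<Sum>us\<in>outcomes ?j. hit pt (branch rs us H F))" for pt H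
    have sum_h: "(\<Sum>pt\<in>Pts. h pt H) = (\<Sum>F\<in>Funs n m. \<Sum>us\<in>outcomes ?j. sqnorm (branch rs us H F))" for H
      unfolding h_def
      by (subst sum.swap, intro sum.cong refl, subst sum.swap, simp add: sum_hit)
    have T1: "(\<Sum>pt\<in>Pts. \<Sum>H\<in>Fcs k n m. \<Sum>y<(2::nat)^m. h pt H) = 2^m * total_weight"
    proof -
      have "(\<Sum>pt\<in>Pts. \<Sum>H\<in>Fcs k n m. \<Sum>y<(2::nat)^m. h pt H) = (\<Sum>H\<in>Fcs k n m. \<Sum>pt\<in>Pts. 2^m * h pt H)"
        by (subst sum.swap) simp
      also have "\<dots> = 2^m * total_weight"
        using sum_sqnorm_branch_Fcs_Funs[OF rs]
        by (simp only: sum_distrib_left[symmetric] sum_h)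
      finally show ?thesis .
    qed
    \<comment> \<open>The resampled \<open>H(pt := y)\<close> is again uniform, so it contributes as
      much as \<open>H\<close> itself.\<close>
    have T2: "(\<Sum>pt\<in>Pts. \<Sum>H\<in>Fcs k n m. \<Sum>y<2^m. h pt (H(pt := y))) = 2^m * total_weight"
      unfolding T1[symmetric] by (intro sum.cong[OF refl] sum_Fcs_fun_upd)
    note bound
    also have "(\<Sum>pt\<in>Pts. \<Sum>H\<in>Fcs k n m. \<Sum>y<2^m. \<Sum>F\<in>Funs n m. \<Sum>us\<in>outcomes ?j.
       sqdist (branch rs us (H(pt := y)) F) (branch rs us H F)
       + 2 * hit pt (branch rs us (H(pt := y)) F) + 2 * hit pt (branch rs us H F))
      = influence rs + 2 * (\<Sum>pt\<in>Pts. \<Sum>H\<in>Fcs k n m. \<Sum>y<2^m. h pt (H(pt := y)))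
         + 2 * (\<Sum>pt\<in>Pts. \<Sum>H\<in>Fcs k n m. \<Sum>y<(2::nat)^m. h pt H)"
      by (simp only: sum.distrib influence_def h_def sum_distrib_left)
    finally have "influence (st # rs) \<le> influence rs + 2 * (2^m * total_weight) + 2 * (2^m * total_weight)"
      unfolding T1 T2 .
    then show ?thesis using IH True by (simp add: algebra_simps)
  qed
qed

section \<open>Growth of the distance between real and ideal states with each query\<close>

definition fam_dist :: "nat \<Rightarrow> (nat \<times> nat \<Rightarrow> (nat \<times> nat \<Rightarrow> nat) \<Rightarrow> (nat \<Rightarrow> nat) \<Rightarrow> nat list \<Rightarrow> qstate) \<Rightarrow>
    (nat \<times> nat \<Rightarrow> (nat \<times> nat \<Rightarrow> nat) \<Rightarrow> (nat \<Rightarrow> nat) \<Rightarrow> nat list \<Rightarrow> qstate) \<Rightarrow> real" where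
  "fam_dist j X Y = sqrt (\<Sum>K\<in>Pts. \<Sum>H\<in>Fcs k n m. \<Sum>F\<in>Funs n m. \<Sum>us\<in>outcomes j.
     sqdist (X K H F us) (Y K H F us))"

lemma fam_dist_eq_L2_set:
  "fam_dist j X Y = L2_set (\<lambda>(K, H, F, us, b). cmod (X K H F us b - Y K H F us b))
     (Pts \<times> Fcs k n m \<times> Funs n m \<times> outcomes j \<times> S)"
  unfolding fam_dist_def L2_set_def sqdist_def sum.cartesian_product by (simp add: case_prod_unfold)

lemma fam_dist_triangle: "fam_dist j X Z \<le> fam_dist j X Y + fam_dist j Y Z"
proof -
  let ?I = "Pts \<times> Fcs k n m \<times> Funs n m \<times> outcomes j \<times> S"
  have "fam_dist j X Z \<le> L2_set (\<lambda>i.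
      (\<lambda>(K, H, F, us, b). cmod (X K H F us b - Y K H F us b)) i +
      (\<lambda>(K, H, F, us, b). cmod (Y K H F us b - Z K H F us b)) i) ?I"
    unfolding fam_dist_eq_L2_set
    by (intro L2_set_mono) (auto intro: order_trans[OF _ norm_triangle_ineq])
  also have "\<dots> \<le> fam_dist j X Y + fam_dist j Y Z"
    unfolding fam_dist_eq_L2_set by (rule L2_set_triangle_ineq)
  finally show ?thesis .
qed

text \<open>\<open>H\<close> is reprogrammed at all outcomes of the branch from the first step on,
  even at those measured only after a given query to \<open>H\<close>. This is the real game after
  the exchange.\<close>

definition real_state where
  "real_state rs K H F us = branch rs us (reprog K (set us) H F) F"

definition ideal_state where
  "ideal_state rs (K :: nat \<times> nat) H F us = branch rs us H F"

text \<open>Both oracles act on the same state, so components off the reprogrammed points cancel. On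
  these points both images have the weight of \<open>\<psi>\<close>, which gives 2 + 2 = 4.\<close>

lemma sqdist_oracle_H_reprog:
  assumes "H \<in> Fcs k n m" "F \<in> Funs n m" "K \<in> Pts" "V \<subseteq> {..<2^n}"
  shows "sqdist (oracle_H S (reprog K V H F) \<psi>) (oracle_H S H \<psi>)
    \<le> 4 * (\<Sum>b\<in>S. of_bool (fst b = fst K \<and> Bit_Operations.xor (fst (snd b)) (snd K) \<in> V) * (cmod (\<psi> b))\<^sup>2)"
proof -
  define g :: "nat \<times> nat \<Rightarrow> real"
    where "g pt = of_bool (fst pt = fst K \<and> Bit_Operations.xor (snd pt) (snd K) \<in> V)" for pt
  let ?G = "reprog K V H F"
  have G: "?G \<in> Fcs k n m" using assms by (rule reprog_in_Fcs)
  have "sqdist (oracle_H S ?G \<psi>) (oracle_H S H \<psi>)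
      \<le> (\<Sum>b\<in>S. 2 * (g (fst b, fst (snd b)) * (cmod (oracle_H S ?G \<psi> b))\<^sup>2)
            + 2 * (g (fst b, fst (snd b)) * (cmod (oracle_H S H \<psi> b))\<^sup>2))"
    unfolding sqdist_def
  proof (rule sum_mono)
    fix b assume "b \<in> S"
    show "(cmod (oracle_H S ?G \<psi> b - oracle_H S H \<psi> b))\<^sup>2
       \<le> 2 * (g (fst b, fst (snd b)) * (cmod (oracle_H S ?G \<psi> b))\<^sup>2)
            + 2 * (g (fst b, fst (snd b)) * (cmod (oracle_H S H \<psi> b))\<^sup>2)"
    proof (cases "fst b = fst K \<and> Bit_Operations.xor (fst (snd b)) (snd K) \<in> V")
      case True
      then show ?thesis using cmod_diff_square_le by (simp add: g_def)
    next
      case False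
      then have "oracle_H S ?G \<psi> b = oracle_H S H \<psi> b"
        by (cases b) (auto simp: oracle_H_def reprog_def)
      then show ?thesis by (simp add: g_def)
    qed
  qed
  also have "\<dots> = 4 * (\<Sum>b\<in>S. g (fst b, fst (snd b)) * (cmod (\<psi> b))\<^sup>2)"
    using sum_oracle_H[OF assms(1), of g d \<psi> "\<lambda>_. 0"] sum_oracle_H[OF G, of g d \<psi> "\<lambda>_. 0"]
    by (simp add: sum.distrib sum_distrib_left[symmetric])
  finally show ?thesis by (simp add: g_def)
qed

text \<open>A query \<open>(a, x)\<close> meets a reprogrammed point only if \<open>snd K\<close> is
  the XOR of \<open>x\<close> with some outcome: at most one key per entry of
  \<open>us\<close>.\<close>

lemma card_keys_le:
  "card {K \<in> Pts. a = fst K \<and> Bit_Operations.xor x (snd K) \<in> set us} \<le> length us"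
proof -
  have "{K \<in> Pts. a = fst K \<and> Bit_Operations.xor x (snd K) \<in> set us}
      \<subseteq> (\<lambda>u. (a, Bit_Operations.xor u x)) ` set us"
  proof
    fix K assume K: "K \<in> {K \<in> Pts. a = fst K \<and> Bit_Operations.xor x (snd K) \<in> set us}"
    then have "K = (a, Bit_Operations.xor (Bit_Operations.xor x (snd K)) x)"
      by (auto simp: prod_eq_iff)
    with K show "K \<in> (\<lambda>u. (a, Bit_Operations.xor u x)) ` set us" by blast
  qed
  then have "card {K \<in> Pts. a = fst K \<and> Bit_Operations.xor x (snd K) \<in> set us} \<le> card (set us)"
    by (rule surj_card_le[rotated]) simp
  then show ?thesis using card_length[of us] by linarith
qed

text \<open>As \<open>\<psi>\<close> does not depend on the key, the keys can be counted first,
  separately for each basis state.\<close>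

lemma sum_sqdist_oracle_H_reprog:
  assumes "H \<in> Fcs k n m" "F \<in> Funs n m" "us \<in> outcomes j"
  shows "(\<Sum>K\<in>Pts. sqdist (oracle_H S (reprog K (set us) H F) \<psi>) (oracle_H S H \<psi>))
    \<le> 4 * real j * sqnorm \<psi>"
proof -
  let ?c = "\<lambda>K b. fst b = fst K \<and> Bit_Operations.xor (fst (snd b)) (snd K) \<in> set us"
  have "(\<Sum>K\<in>Pts. sqdist (oracle_H S (reprog K (set us) H F) \<psi>) (oracle_H S H \<psi>))
    \<le> (\<Sum>K\<in>Pts. 4 * (\<Sum>b\<in>S. of_bool (?c K b) * (cmod (\<psi> b))\<^sup>2))"
    using assms outcomes_subset by (intro sum_mono sqdist_oracle_H_reprog) blast+
  also have "\<dots> = 4 * (\<Sum>b\<in>S. (\<Sum>K\<in>Pts. of_bool (?c K b)) * (cmod (\<psi> b))\<^sup>2)"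
    by (simp only: sum_distrib_left[symmetric] sum_distrib_right) (simp only: sum.swap[of _ S])
  also have "\<dots> \<le> 4 * (\<Sum>b\<in>S. real j * (cmod (\<psi> b))\<^sup>2)"
  proof (intro mult_left_mono sum_mono mult_right_mono)
    fix b :: basis
    have "(\<Sum>K\<in>Pts. of_bool (?c K b)) = real (card {K \<in> Pts. ?c K b})"
      by (simp add: Int_def)
    also have "\<dots> \<le> real j"
      using card_keys_le[of "fst b" "fst (snd b)" us] outcomes_length[OF assms(3)] by simp
    finally show "(\<Sum>K\<in>Pts. of_bool (?c K b)) \<le> real j" .
  qed auto
  finally show ?thesis by (simp add: sqnorm_def sum_distrib_left mult.assoc)
qed

text \<open>The hybrid \<open>Y\<close> feeds the ideal state to the reprogrammed oracle. Between
  \<open>X\<close> and \<open>Y\<close> only the states differ, under a common isometry; between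
  \<open>Y\<close> and \<open>Z\<close> only the oracles differ, on a state independent of the
  key.\<close>

lemma fam_dist_query_H:
  assumes "fst st" "unitary_steps (st # rs)"
  defines "j \<equiv> num_Ev rs"
  shows "fam_dist j (real_state (st # rs)) (ideal_state (st # rs))
     \<le> fam_dist j (real_state rs) (ideal_state rs) + 2 * sqrt (real j * total_weight)"
proof -
  have U: "unitary_on S (snd st)" and rs: "unitary_steps rs" using assms(2) by auto
  let ?G = "\<lambda>K us H F. reprog K (set us) H F"
  define X where "X K H F us = oracle_H S (?G K us H F) (real_state rs K H F us)" for K H F us
  define Y where "Y K H F us = oracle_H S (?G K us H F) (ideal_state rs K H F us)" for K H F us
  define Z where "Z K H F us = oracle_H S H (ideal_state rs K H F us)" for K H F us
  have "fam_dist j (real_state (st # rs)) (ideal_state (st # rs)) = fam_dist j X Z"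
    unfolding fam_dist_def
    using assms(1) U by (simp add: real_state_def ideal_state_def X_def Z_def sqdist_apply_op)
  also have "\<dots> \<le> fam_dist j X Y + fam_dist j Y Z"
    by (rule fam_dist_triangle)
  also have "fam_dist j X Y = fam_dist j (real_state rs) (ideal_state rs)"
    unfolding fam_dist_def X_def Y_def
    by (intro arg_cong[where f = sqrt] sum.cong[OF refl] sqdist_oracle_H reprog_in_Fcs outcomes_subset)
  also have "fam_dist j Y Z \<le> 2 * sqrt (real j * total_weight)"
  proof -
    have "(\<Sum>K\<in>Pts. \<Sum>H\<in>Fcs k n m. \<Sum>F\<in>Funs n m. \<Sum>us\<in>outcomes j. sqdist (Y K H F us) (Z K H F us))
        = (\<Sum>H\<in>Fcs k n m. \<Sum>F\<in>Funs n m. \<Sum>us\<in>outcomes j. \<Sum>K\<in>Pts. sqdist (Y K H F us) (Z K H F us))"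
      by (simp only: sum.swap[where B = Pts])
    also have "\<dots> \<le> (\<Sum>H\<in>Fcs k n m. \<Sum>F\<in>Funs n m. \<Sum>us\<in>outcomes j. 4 * real j * sqnorm (branch rs us H F))"
      unfolding Y_def Z_def ideal_state_def by (intro sum_mono sum_sqdist_oracle_H_reprog)
    also have "\<dots> = 4 * (real j * total_weight)"
      using sum_sqnorm_branch_Fcs_Funs[OF rs] by (simp add: sum_distrib_left[symmetric] j_def)
    finally have "fam_dist j Y Z \<le> sqrt (4 * (real j * total_weight))"
      unfolding fam_dist_def by (rule real_sqrt_le_mono)
    then show ?thesis by (simp add: real_sqrt_mult)
  qed
  finally show ?thesis by simp
qed

text \<open>For a repeated \<open>u\<close> nothing is exchanged and the left side vanishes. For a
  fresh \<open>u\<close> the branches do not depend on \<open>F u\<close>, which can thus play the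
  independent new value \<open>y\<close> of \<open>H\<close>; the factor \<open>2^m\<close> pays for
  the additional sum over \<open>y\<close>.\<close>

lemma sum_reprog_singleton:
  assumes "K \<in> Pts" "H \<in> Fcs k n m" "us \<in> outcomes (num_Ev rs)" "u < 2^n"
  shows "2^m * (\<Sum>F\<in>Funs n m.
      sqdist (proj_u u (branch rs us (reprog K ({u} - set us) H F) (reprog_back K ({u} - set us) H F)))
             (proj_u u (branch rs us H F)))
    \<le> (\<Sum>F\<in>Funs n m. \<Sum>y<2^m.
      sqdist (proj_u u (branch rs us (H((fst K, Bit_Operations.xor (snd K) u) := y)) F))
             (proj_u u (branch rs us H F)))"
proof (cases "u \<in> set us")
  case True
  then have "reprog K ({u} - set us) H F = H" "reprog_back K ({u} - set us) H F = F" for F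
    by (auto simp: reprog_def reprog_back_def fun_eq_iff)
  then show ?thesis by (simp add: sum_nonneg)
next
  case False
  let ?pt = "(fst K, Bit_Operations.xor (snd K) u)"
  define g where "g F y = sqdist (proj_u u (branch rs us (H(?pt := y)) F))
             (proj_u u (branch rs us H F))" for F y
  have len: "length us = num_Ev rs" using outcomes_length[OF assms(3)] .
  have V: "{u} - set us = {u}" using False by auto
  have cong: "branch rs us H' (reprog_back K {u} H F) = branch rs us H' F" for H' F
    using False len by (intro branch_cong) (auto simp: reprog_back_def)
  have "branch rs us H' (F(u := y)) = branch rs us H' F" for H' F y
    using False len by (intro branch_cong) auto
  then have "g (F(u := y)) z = g F z" for F y z
    by (simp add: g_def)
  then have "2^m * (\<Sum>F\<in>Funs n m. g F (F u)) = (\<Sum>F\<in>Funs n m. \<Sum>y<2^m. g F y)"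
    using sum_Funs_fun_upd[OF assms(4), of g] by (simp add: sum_distrib_left)
  then show ?thesis
    unfolding V cong g_def
    using reprog_singleton[of "fst K" "snd K" u H] by simp
qed

text \<open>A fresh outcome \<open>u\<close> reprograms \<open>H\<close> for all earlier queries
  too. By \<open>reprog_insert\<close> the new real state is the old one at the pair exchanged at
  \<open>u\<close>, which is what \<open>swapped\<close> expresses. Swapping both old families keeps
  their distance, since the exchange permutes the pairs; what remains is the effect of the exchange
  on the ideal state, bounded by \<open>influence\<close>.\<close>

lemma fam_dist_query_Ev:
  assumes "\<not> fst st" "unitary_steps (st # rs)"
  defines "j \<equiv> num_Ev rs"
  shows "fam_dist (Suc j) (real_state (st # rs)) (ideal_state (st # rs))
     \<le> fam_dist j (real_state rs) (ideal_state rs) + 2 * sqrt (real (num_H rs) * total_weight)"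
proof -
  have U: "unitary_on S (snd st)" and rs: "unitary_steps rs" using assms(2) by auto
  let ?V = "\<lambda>us. {hd us} - set (tl us)"
  define swapped where "swapped f K H F us =
      proj_u (hd us) (f K (reprog K (?V us) H F) (reprog_back K (?V us) H F) (tl us))"
    for f :: "nat \<times> nat \<Rightarrow> (nat \<times> nat \<Rightarrow> nat) \<Rightarrow> (nat \<Rightarrow> nat) \<Rightarrow> nat list \<Rightarrow> qstate" and K H F us
  define Z where "Z K H F us = proj_u (hd us) (ideal_state rs K H F (tl us))" for K H F us
  have real_swapped: "branch rs us (reprog K (set (u # us)) H F) F
      = real_state rs K (reprog K ({u} - set us) H F) (reprog_back K ({u} - set us) H F) us"
    if "us \<in> outcomes j" for u us K H F
    unfolding real_state_def reprog_insert
    using outcomes_length[OF that] by (intro branch_cong) (auto simp: reprog_back_def j_def)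
  have "fam_dist (Suc j) (real_state (st # rs)) (ideal_state (st # rs))
      = fam_dist (Suc j) (swapped (real_state rs)) Z"
    unfolding fam_dist_def sum_outcomes_Suc
  proof (intro arg_cong[where f = sqrt] sum.cong[OF refl])
    fix K H F us u
    assume *: "H \<in> Fcs k n m" "F \<in> Funs n m" "us \<in> outcomes j"
    have "real_state (st # rs) K H F (u # us) = apply_op S (snd st) (oracle_Ev S F
       (swapped (real_state rs) K H F (u # us)))"
      unfolding swapped_def list.sel real_swapped[OF *(3), symmetric]
      using assms(1) by (simp add: real_state_def)
    moreover have "ideal_state (st # rs) K H F (u # us) = apply_op S (snd st) (oracle_Ev S F (Z K H F (u # us)))"
      using assms(1) by (simp add: ideal_state_def Z_def)
    ultimately show "sqdist (real_state (st # rs) K H F (u # us)) (ideal_state (st # rs) K H F (u # us))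
        = sqdist (swapped (real_state rs) K H F (u # us)) (Z K H F (u # us))"
      using * by (simp add: sqdist_apply_op[OF U] sqdist_oracle_Ev Funs_less)
  qed
  also have "\<dots> \<le> fam_dist (Suc j) (swapped (real_state rs)) (swapped (ideal_state rs))
      + fam_dist (Suc j) (swapped (ideal_state rs)) Z"
    by (rule fam_dist_triangle)
  also have "fam_dist (Suc j) (swapped (real_state rs)) (swapped (ideal_state rs))
      = fam_dist j (real_state rs) (ideal_state rs)"
    unfolding fam_dist_def
  proof (rule arg_cong[where f = sqrt], rule sum.cong[OF refl])
    fix K assume K: "K \<in> Pts"
    define f where "f us H F = sqdist (proj_u (hd us) (real_state rs K H F (tl us)))
        (proj_u (hd us) (ideal_state rs K H F (tl us)))" for us H F
    have "(\<Sum>H\<in>Fcs k n m. \<Sum>F\<in>Funs n m. \<Sum>us\<in>outcomes (Suc j).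
          sqdist (swapped (real_state rs) K H F us) (swapped (ideal_state rs) K H F us))
        = (\<Sum>us\<in>outcomes (Suc j). \<Sum>H\<in>Fcs k n m. \<Sum>F\<in>Funs n m.
            f us (reprog K (?V us) H F) (reprog_back K (?V us) H F))"
      unfolding swapped_def f_def by (simp only: sum.swap[where B = "outcomes (Suc j)"])
    also have "\<dots> = (\<Sum>us\<in>outcomes (Suc j). \<Sum>H\<in>Fcs k n m. \<Sum>F\<in>Funs n m. f us H F)"
    proof (rule sum.cong[OF refl])
      fix us assume "us \<in> outcomes (Suc j)"
      then have "?V us \<subseteq> {..<2^n}" by (auto simp: outcomes_def length_Suc_conv)
      then show "(\<Sum>H\<in>Fcs k n m. \<Sum>F\<in>Funs n m. f us (reprog K (?V us) H F) (reprog_back K (?V us) H F))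
          = (\<Sum>H\<in>Fcs k n m. \<Sum>F\<in>Funs n m. f us H F)"
        by (rule sum_reprog[OF K])
    qed
    also have "\<dots> = (\<Sum>H\<in>Fcs k n m. \<Sum>F\<in>Funs n m. \<Sum>us\<in>outcomes (Suc j). f us H F)"
      by (simp only: sum.swap[where B = "outcomes (Suc j)"])
    also have "\<dots> = (\<Sum>H\<in>Fcs k n m. \<Sum>F\<in>Funs n m. \<Sum>us\<in>outcomes j.
        sqdist (real_state rs K H F us) (ideal_state rs K H F us))"
      unfolding sum_outcomes_Suc f_def list.sel sum_sqdist_proj_u ..
    finally show "(\<Sum>H\<in>Fcs k n m. \<Sum>F\<in>Funs n m. \<Sum>us\<in>outcomes (Suc j).
          sqdist (swapped (real_state rs) K H F us) (swapped (ideal_state rs) K H F us))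
        = (\<Sum>H\<in>Fcs k n m. \<Sum>F\<in>Funs n m. \<Sum>us\<in>outcomes j.
          sqdist (real_state rs K H F us) (ideal_state rs K H F us))" .
  qed
  also have "fam_dist (Suc j) (swapped (ideal_state rs)) Z \<le> 2 * sqrt (real (num_H rs) * total_weight)"
  proof -
    define T where "T = (\<Sum>K\<in>Pts. \<Sum>H\<in>Fcs k n m. \<Sum>F\<in>Funs n m. \<Sum>us\<in>outcomes (Suc j).
        sqdist (swapped (ideal_state rs) K H F us) (Z K H F us))"
    define D where "D u us pt H F y = sqdist (proj_u u (branch rs us (H(pt := y)) F))
        (proj_u u (branch rs us H F))" for u us pt H F y
    have "2^m * T = (\<Sum>K\<in>Pts. \<Sum>H\<in>Fcs k n m. \<Sum>us\<in>outcomes j. \<Sum>u<2^n. 2^m * (\<Sum>F\<in>Funs n m.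
          sqdist (proj_u u (branch rs us (reprog K ({u} - set us) H F) (reprog_back K ({u} - set us) H F)))
            (proj_u u (branch rs us H F))))"
      unfolding T_def sum_outcomes_Suc swapped_def Z_def ideal_state_def list.sel
        sum_distrib_left[symmetric] sum.swap[where A = "Funs n m"] ..
    also have "\<dots> \<le> (\<Sum>K\<in>Pts. \<Sum>H\<in>Fcs k n m. \<Sum>us\<in>outcomes j. \<Sum>u<2^n. \<Sum>F\<in>Funs n m. \<Sum>y<2^m.
        D u us (fst K, Bit_Operations.xor (snd K) u) H F y)"
      unfolding D_def by (intro sum_mono sum_reprog_singleton) (auto simp: j_def)
    also have "\<dots> = (\<Sum>H\<in>Fcs k n m. \<Sum>us\<in>outcomes j. \<Sum>u<2^n. \<Sum>K\<in>Pts. \<Sum>F\<in>Funs n m. \<Sum>y<2^m.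
        D u us (fst K, Bit_Operations.xor (snd K) u) H F y)"
      by (simp only: sum.swap[where B = Pts])
    \<comment> \<open>XOR with a fixed \<open>u\<close> permutes the keys: the reprogrammed point is
      uniform because the key is.\<close>
    also have "\<dots> = (\<Sum>H\<in>Fcs k n m. \<Sum>us\<in>outcomes j. \<Sum>u<2^n. \<Sum>pt\<in>Pts. \<Sum>F\<in>Funs n m. \<Sum>y<2^m.
        D u us pt H F y)"
    proof (rule sum.cong[OF refl], rule sum.cong[OF refl], rule sum.cong[OF refl])
      fix H us and u :: nat assume "u \<in> {..<2^n}"
      then show "(\<Sum>K\<in>Pts. \<Sum>F\<in>Funs n m. \<Sum>y<2^m. D u us (fst K, Bit_Operations.xor (snd K) u) H F y)
          = (\<Sum>pt\<in>Pts. \<Sum>F\<in>Funs n m. \<Sum>y<2^m. D u us pt H F y)"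
        by (intro sum.reindex_bij_witness[of _ "\<lambda>K. (fst K, Bit_Operations.xor (snd K) u)"
              "\<lambda>K. (fst K, Bit_Operations.xor (snd K) u)"]) (auto simp: xor_less_power_2)
    qed
    also have "\<dots> = (\<Sum>pt\<in>Pts. \<Sum>H\<in>Fcs k n m. \<Sum>us\<in>outcomes j. \<Sum>F\<in>Funs n m. \<Sum>y<2^m. \<Sum>u<2^n.
        D u us pt H F y)"
      by (simp only: sum.swap[where B = Pts]) (simp only: sum.swap[where A = "{..<(2::nat)^n}"])
    \<comment> \<open>Summing over \<open>u\<close> reassembles whole branches from their
      projections.\<close>
    also have "\<dots> = (\<Sum>pt\<in>Pts. \<Sum>H\<in>Fcs k n m. \<Sum>us\<in>outcomes j. \<Sum>F\<in>Funs n m. \<Sum>y<2^m.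
        sqdist (branch rs us (H(pt := y)) F) (branch rs us H F))"
      unfolding D_def sum_sqdist_proj_u ..
    also have "\<dots> = influence rs"
      unfolding influence_def j_def
      by (intro sum.cong[OF refl]) (simp only: sum.swap[where A = "outcomes (num_Ev rs)"], rule sum.swap)
    also have "\<dots> \<le> 2^m * (4 * (real (num_H rs) * total_weight))"
      using influence_le[OF rs] by (simp add: mult_ac)
    finally have "T \<le> 4 * (real (num_H rs) * total_weight)"
      by simp
    then have "fam_dist (Suc j) (swapped (ideal_state rs)) Z \<le> sqrt (4 * (real (num_H rs) * total_weight))"
      unfolding fam_dist_def T_def by (rule real_sqrt_le_mono)
    then show ?thesis by (simp add: real_sqrt_mult)
  qed
  finally show ?thesis by simp
qed

section \<open>Accumulation over all steps and acceptance probabilities\<close>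

text \<open>After \<open>i\<close> queries to \<open>H\<close> and \<open>j\<close> to
  \<open>Ev\<close>, the next query costs \<open>2 * sqrt (j * total_weight)\<close> if it goes to
  \<open>H\<close> and \<open>2 * sqrt (i * total_weight)\<close> if it goes to \<open>Ev\<close>.
  As the counts only grow, the bound holds for every order of the queries.\<close>

lemma fam_dist_le:
  assumes "unitary_steps rs"
  shows "fam_dist (num_Ev rs) (real_state rs) (ideal_state rs)
    \<le> 2 * sqrt total_weight *
        (real (num_H rs) * sqrt (real (num_Ev rs)) + real (num_Ev rs) * sqrt (real (num_H rs)))"
  using assms
proof (induction rs)
  case Nil
  then show ?case by (simp add: fam_dist_def real_state_def ideal_state_def)
next
  case (Cons st rs)
  let ?i = "num_H rs" and ?j = "num_Ev rs" and ?w = "sqrt total_weight"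
  have IH: "fam_dist ?j (real_state rs) (ideal_state rs)
      \<le> 2 * ?w * (real ?i * sqrt (real ?j) + real ?j * sqrt (real ?i))"
    using Cons by simp
  have w: "0 \<le> ?w" by (simp add: total_weight_def)
  show ?case
  proof (cases "fst st")
    case True
    have "fam_dist ?j (real_state (st # rs)) (ideal_state (st # rs))
        \<le> 2 * ?w * (real ?i * sqrt (real ?j) + real ?j * sqrt (real ?i) + sqrt (real ?j))"
      using fam_dist_query_H[OF True Cons.prems] IH
      by (simp add: real_sqrt_mult algebra_simps)
    also have "\<dots> \<le> 2 * ?w * (real (Suc ?i) * sqrt (real ?j) + real ?j * sqrt (real (Suc ?i)))"
    proof (rule mult_left_mono)
      have "real ?j * sqrt (real ?i) \<le> real ?j * sqrt (real (Suc ?i))"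
        by (intro mult_left_mono) auto
      then show "real ?i * sqrt (real ?j) + real ?j * sqrt (real ?i) + sqrt (real ?j)
          \<le> real (Suc ?i) * sqrt (real ?j) + real ?j * sqrt (real (Suc ?i))"
        by (simp add: distrib_right)
    qed (use w in simp)
    finally show ?thesis using True by simp
  next
    case False
    have "fam_dist (Suc ?j) (real_state (st # rs)) (ideal_state (st # rs))
        \<le> 2 * ?w * (real ?i * sqrt (real ?j) + real ?j * sqrt (real ?i) + sqrt (real ?i))"
      using fam_dist_query_Ev[OF False Cons.prems] IH
      by (simp add: real_sqrt_mult algebra_simps)
    also have "\<dots> \<le> 2 * ?w * (real ?i * sqrt (real (Suc ?j)) + real (Suc ?j) * sqrt (real ?i))"
    proof (rule mult_left_mono)
      have "real ?i * sqrt (real ?j) \<le> real ?i * sqrt (real (Suc ?j))"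
        by (intro mult_left_mono) auto
      then show "real ?i * sqrt (real ?j) + real ?j * sqrt (real ?i) + sqrt (real ?i)
          \<le> real ?i * sqrt (real (Suc ?j)) + real (Suc ?j) * sqrt (real ?i)"
        by (simp add: distrib_right)
    qed (use w in simp)
    finally show ?thesis using False by simp
  qed
qed

text \<open>On the outcomes \<open>us\<close>, \<open>FFX\<close> of the reprogrammed function
  agrees with \<open>F\<close>, so each branch is one of the real game for that function. For fixed
  \<open>us\<close> the exchange then replaces the reprogrammed function by a uniform one.\<close>

lemma sum_real_state:
  fixes f :: "qstate \<Rightarrow> real"
  assumes K: "K \<in> Pts"
  shows "(\<Sum>H\<in>Fcs k n m. \<Sum>F\<in>Funs n m. \<Sum>us\<in>outcomes (num_Ev rs). f (real_state rs K H F us))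
    = (\<Sum>H\<in>Fcs k n m. \<Sum>F\<in>Funs n m. \<Sum>us\<in>outcomes (num_Ev rs).
         f (branch rs us H (FFX H (fst K) (snd K))))"
proof -
  let ?O = "outcomes (num_Ev rs)"
  have eq: "real_state rs K H F us = branch rs us (reprog K (set us) H F)
      (FFX (reprog K (set us) H F) (fst K) (snd K))" if "us \<in> ?O" for H F us
    unfolding real_state_def
    using outcomes_length[OF that] by (intro branch_cong) (auto simp: FFX_def reprog_def)
  have "(\<Sum>H\<in>Fcs k n m. \<Sum>F\<in>Funs n m. \<Sum>us\<in>?O. f (real_state rs K H F us))
      = (\<Sum>us\<in>?O. \<Sum>H\<in>Fcs k n m. \<Sum>F\<in>Funs n m. f (branch rs us (reprog K (set us) H F)
      (FFX (reprog K (set us) H F) (fst K) (snd K))))"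
    by (simp only: sum.swap[where B = ?O]) (intro sum.cong[OF refl], simp only: eq)
  also have "\<dots> = (\<Sum>us\<in>?O. \<Sum>H\<in>Fcs k n m. \<Sum>F\<in>Funs n m. f (branch rs us H (FFX H (fst K) (snd K))))"
    by (rule sum.cong[OF refl], rule sum_reprog[OF K, where f = "\<lambda>H _. f (branch rs _ H (FFX H (fst K) (snd K)))"])
       (rule outcomes_subset)
  also have "\<dots> = (\<Sum>H\<in>Fcs k n m. \<Sum>F\<in>Funs n m. \<Sum>us\<in>?O. f (branch rs us H (FFX H (fst K) (snd K))))"
    by (simp only: sum.swap[where B = ?O])
  finally show ?thesis .
qed

lemma FFX_less:
  "H \<in> Fcs k n m \<Longrightarrow> K \<in> Pts \<Longrightarrow> u < 2^n \<Longrightarrow> FFX H (fst K) (snd K) u < 2^m"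
  by (auto simp: FFX_def Fcs_less xor_less_power_2)

text \<open>Keys, functions, outcomes and basis states are treated as one joint index set, on which
  both families have the same total weight; \<open>measurement_gap_le\<close> then applies
  once.\<close>

lemma sum_acc_weight_diff_le:
  assumes rs: "unitary_steps rs"
  shows "(\<Sum>K\<in>Pts. \<Sum>H\<in>Fcs k n m. \<Sum>F\<in>Funs n m. \<Sum>us\<in>outcomes (num_Ev rs). acc_weight acc (real_state rs K H F us))
     - (\<Sum>K\<in>Pts. \<Sum>H\<in>Fcs k n m. \<Sum>F\<in>Funs n m. \<Sum>us\<in>outcomes (num_Ev rs). acc_weight acc (ideal_state rs K H F us))
    \<le> fam_dist (num_Ev rs) (real_state rs) (ideal_state rs) * sqrt (2^(k+n) * total_weight)"
proof -
  let ?I = "Pts \<times> Fcs k n m \<times> Funs n m \<times> outcomes (num_Ev rs) \<times> S"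
  let ?P = "{(K, H, F, us, b). b \<in> acc}"
  let ?a = "\<lambda>(K, H, F, us, b). real_state rs K H F us b"
  let ?b = "\<lambda>(K, H, F, us, b). ideal_state rs K H F us b"
  have sum_I: "(\<Sum>K\<in>Pts. \<Sum>H\<in>Fcs k n m. \<Sum>F\<in>Funs n m. \<Sum>us\<in>outcomes (num_Ev rs). sqnorm (X K H F us))
      = (\<Sum>i\<in>?I. (cmod ((\<lambda>(K, H, F, us, b). X K H F us b) i))\<^sup>2)" for X
    unfolding sqnorm_def sum.cartesian_product by (simp add: case_prod_unfold)
  have "(\<Sum>H\<in>Fcs k n m. \<Sum>F\<in>Funs n m. \<Sum>us\<in>outcomes (num_Ev rs). sqnorm (real_state rs K H F us))
      = total_weight" if K: "K \<in> Pts" for K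
    unfolding sum_real_state[OF K]
    using rs K by (simp add: sum_sqnorm_branch FFX_less total_weight_def)
  then have a: "(\<Sum>i\<in>?I. (cmod (?a i))\<^sup>2) = 2^(k+n) * total_weight"
    unfolding sum_I[symmetric] by (simp add: power_add)
  have b: "(\<Sum>i\<in>?I. (cmod (?b i))\<^sup>2) = 2^(k+n) * total_weight"
    using sum_sqnorm_branch_Fcs_Funs[OF rs]
    unfolding sum_I[symmetric] by (simp add: ideal_state_def power_add)
  have "(\<Sum>i\<in>?I. if i \<in> ?P then (cmod (?a i))\<^sup>2 else 0) - (\<Sum>i\<in>?I. if i \<in> ?P then (cmod (?b i))\<^sup>2 else 0)
      \<le> L2_set (\<lambda>i. cmod (?a i - ?b i)) ?I * sqrt (2^(k+n) * total_weight)"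
    by (rule measurement_gap_le[OF a b])
  then show ?thesis
    unfolding fam_dist_eq_L2_set acc_weight_def sum.cartesian_product
    by (simp add: case_prod_unfold cong: if_cong)
qed

end

section \<open>Normalisation and the final estimate\<close>

lemma card_Fcs_pos: "0 < card (Fcs k n m)"
  by (simp add: Fcs_def card_PiE)

lemma card_Funs_pos: "0 < card (Funs n m)"
  by (simp add: Funs_def card_PiE)

text \<open>The numerator is \<open>2 * sqrt (p * q) * (sqrt p + sqrt q)\<close>, and the square of
  \<open>sqrt p + sqrt q\<close> is at most \<open>2 * (p + q)\<close>, which produces the
  8.\<close>

lemma query_count_bound:
  fixes p q N :: real
  assumes "0 \<le> p" "0 \<le> q" "0 < N"
  shows "2 * (p * sqrt q + q * sqrt p) / sqrt N \<le> sqrt (8 * (p + q) * p * q / N)"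
proof -
  have sq: "(sqrt p)\<^sup>2 = p" "(sqrt q)\<^sup>2 = q" using assms by auto
  have "(2 * (p * sqrt q + q * sqrt p))\<^sup>2 = 4 * (p * q) * (sqrt p + sqrt q)\<^sup>2"
  proof -
    have "(2 * (x\<^sup>2 * y + y\<^sup>2 * x))\<^sup>2 = 4 * (x\<^sup>2 * y\<^sup>2) * (x + y)\<^sup>2" for x y :: real
      by algebra
    from this[of "sqrt p" "sqrt q"] show ?thesis unfolding sq .
  qed
  also have "\<dots> \<le> 4 * (p * q) * (2 * (p + q))"
    using assms sum_squares_bound[of "sqrt p" "sqrt q"]
    by (intro mult_left_mono) (auto simp: power2_sum)
  finally have "2 * (p * sqrt q + q * sqrt p) \<le> sqrt (8 * (p + q) * p * q)"
    by (intro real_le_rsqrt) (simp add: mult_ac)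
  then show ?thesis
    using assms by (simp add: real_sqrt_divide divide_right_mono)
qed

theorem theorem3:
  fixes k n m d p q :: nat
    and acc :: "basis set" and U0 :: qop and sts :: "(bool \<times> qop) list"
  assumes "unitary_on (Basis k n m d) U0"
    and "\<forall>st\<in>set sts. unitary_on (Basis k n m d) (snd st)"
    and "length (filter fst sts) = p"
    and "length (filter (\<lambda>st. \<not> fst st) sts) = q"
  shows "adv_prf_FFX k n m d acc U0 sts
           \<le> sqrt (8 * (real p + real q) * real p * real q / 2^(k+n))"
proof -
  interpret ffx_game k n m d "apply_op (Basis k n m d) U0 ket0" .
  let ?init = "apply_op (Basis k n m d) U0 ket0" and ?rs = "rev sts"
  let ?O = "outcomes (num_Ev ?rs)"
  define N :: real where "N = 2^(k+n)"
  define C where "C = real (card (Fcs k n m)) * real (card (Funs n m))"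
  define B where "B = real p * sqrt (real q) + real q * sqrt (real p)"
  have N: "0 < N" and C: "0 < C" and B: "0 \<le> B"
    using card_Fcs_pos card_Funs_pos by (auto simp: N_def C_def B_def)
  have rs: "unitary_steps ?rs" using assms(2) by simp
  have p: "num_H ?rs = p" and q: "num_Ev ?rs = q"
    using assms(3,4) by (simp_all add: rev_filter[symmetric])
  \<comment> \<open>Only an inequality: for \<open>d = 0\<close> the basis is empty and the norm is
    0.\<close>
  have init: "sqnorm ?init \<le> 1"
  proof -
    have "sqnorm ?init = sqnorm ket0" using assms(1) by (rule sqnorm_apply_op)
    also have "\<dots> = (\<Sum>b\<in>S. if b = (0,0,0,0,0,0) then 1 else 0)"
      unfolding sqnorm_def ket0_def by (intro sum.cong) auto
    also have "\<dots> \<le> 1" by simp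
    finally show ?thesis .
  qed
  define R where "R = (\<Sum>K\<in>Pts. \<Sum>H\<in>Fcs k n m. \<Sum>F\<in>Funs n m. \<Sum>us\<in>?O. acc_weight acc (real_state ?rs K H F us))"
  define J where "J = (\<Sum>K\<in>Pts. \<Sum>H\<in>Fcs k n m. \<Sum>F\<in>Funs n m. \<Sum>us\<in>?O. acc_weight acc (ideal_state ?rs K H F us))"
  \<comment> \<open>The real game does not involve \<open>F\<close>, so the sum over
    \<open>F\<close> becomes a factor.\<close>
  have "R = real (card (Funs n m)) * (\<Sum>K\<in>Pts. \<Sum>H\<in>Fcs k n m.
      acc_prob k n m d acc H (FFX H (fst K) (snd K)) sts ?init)"
    unfolding R_def acc_prob_eq_sum_branch
    by (subst sum.cong[OF refl sum_real_state]) (simp_all add: sum_distrib_left)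
  also have "(\<Sum>K\<in>Pts. \<Sum>H\<in>Fcs k n m. acc_prob k n m d acc H (FFX H (fst K) (snd K)) sts ?init)
      = (\<Sum>H\<in>Fcs k n m. \<Sum>K1<2^k. \<Sum>K2<2^n. acc_prob k n m d acc H (FFX H K1 K2) sts ?init)"
    by (subst sum.swap) (simp add: sum.cartesian_product case_prod_unfold)
  finally have R: "prf_real k n m d acc U0 sts = R / (C * N)"
    using card_Funs_pos[of n m] card_Fcs_pos[of k n m]
    by (auto simp: prf_real_def C_def N_def power_add field_simps)
  \<comment> \<open>The ideal game does not involve the key, so the sum over keys becomes the factor
    \<open>N\<close>.\<close>
  have "J = N * (\<Sum>H\<in>Fcs k n m. \<Sum>F\<in>Funs n m. acc_prob k n m d acc H F sts ?init)"
    unfolding J_def acc_prob_eq_sum_branch ideal_state_def by (simp add: N_def power_add)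
  then have J: "prf_ideal k n m d acc U0 sts = J / (C * N)"
    using N by (simp add: prf_ideal_def C_def)
  have w: "total_weight = C * sqnorm ?init" "0 \<le> total_weight" "total_weight \<le> C"
    using init C by (simp_all add: total_weight_def C_def mult_left_le)
  have "R - J \<le> fam_dist q (real_state ?rs) (ideal_state ?rs) * sqrt (N * total_weight)"
    using sum_acc_weight_diff_le[OF rs, of acc] unfolding R_def J_def N_def q .
  also have "\<dots> \<le> (2 * sqrt total_weight * B) * sqrt (N * total_weight)"
    using fam_dist_le[OF rs] N w(2) unfolding p q B_def by (intro mult_right_mono) auto
  also have "\<dots> = 2 * B * sqrt N * total_weight"
    using w(2) by (simp add: real_sqrt_mult)
  also have "\<dots> \<le> 2 * B * sqrt N * C"
    using w(3) B N by (intro mult_left_mono) auto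
  finally have "(R - J) / (C * N) \<le> (2 * B * sqrt N * C) / (C * N)"
    using C N by (intro divide_right_mono) auto
  also have "\<dots> = 2 * B / sqrt N"
    using C N by (simp add: field_simps)
  also have "\<dots> \<le> sqrt (8 * (real p + real q) * real p * real q / N)"
    unfolding B_def by (rule query_count_bound) (use N in auto)
  finally show ?thesis
    unfolding adv_prf_FFX_def R J N_def by (simp add: diff_divide_distrib)
qed

end
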